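(* (i) If $F$ is $(L,C,e)$-smooth relative to $\omega$ for some $L>0$, then $v_L(x)\le u_0(x)$ for all $x\in\mathrm{int}(\Omega)$. (ii) If $F$ is $(\mu,C,e)$-strongly convex relative to $\omega$ for some $\mu\ge0$, then $u_0(x)\le v_{\delta\mu}(x)$ for all $x\in\mathrm{int}(\Omega)$.
   Context: $C\subset\mathbb{R}^m$ is a closed, convex, pointed cone with nonempty interior; $y\preceq_C y'$ means $y'-y\in C$. $C^*=\{c^*\in\mathbb{R}^m:\langle c^*,c\rangle\ge 0\ \forall c\in C\}$ and $G=\mathrm{conv}(\{c^*\in C^*:\|c^*\|=1\})$. $\Omega\subset\mathbb{R}^n$ is closed and convex with nonempty interior, $F:\mathbb{R}^n\to\mathbb{R}^m$ is differentiable with Jacobian $JF(x)\in\mathbb{R}^{m\times n}$. Legendre function: a proper closed convex function $\omega$ on $\mathbb{R}^n$ with values in $(-\infty,+\infty]$ that is essentially smooth (differentiable on $\mathrm{int}(\mathrm{dom}\,\omega)$, with $\|\nabla\omega(x^k)\|\to\infty$ for every sequence $\{x^k\}\subset\mathrm{int}(\mathrm{dom}\,\omega)$ converging to a boundary point of $\mathrm{dom}\,\omega$) and strictly convex on $\mathrm{int}(\mathrm{dom}\,\omega)$. Here $\omega$ is a Legendre function with $\mathrm{cl}(\mathrm{dom}\,\omega)=\Omega$. Bregman distance: $D_\omega(x,y)=\omega(x)-\omega(y)-\langle\nabla\omega(y),x-y\rangle$ for $y\in\mathrm{int}(\mathrm{dom}\,\omega)$ (equal to $+\infty$ when $\omega(x)=+\infty$).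 The vector $e$: $e=\arg\max_{c\in B[0,r]}\min_{c^*\in G}\langle c^*,c\rangle$, where $B[0,r]$ is the closed ball of radius $r$ centred at $0$ and $r>0$ is selected so that $\max_{c^*\in G}\langle c^*,e\rangle=1$; then $e\in\mathrm{int}(C)$. Set $\delta=\min_{c^*\in G}\langle c^*,e\rangle>0$. Relative smoothness: $F$ is $(L,C,e)$-smooth relative to $\omega$ (on $\Omega\subseteq\mathrm{dom}(\omega)$), with $L>0$, if $F(y)\preceq_C F(x)+JF(x)(y-x)+LD_\omega(y,x)e$ for all $x,y\in\mathrm{int}(\Omega)$. Relative strong convexity: $F$ is $(\mu,C,e)$-strongly convex relative to $\omega$ (on $\Omega\subseteq\mathrm{dom}(\omega)$), with $\mu\ge0$, if $F(x)+JF(x)(y-x)+\mu D_\omega(y,x)e\preceq_C F(y)$ for all $x,y\in\mathrm{int}(\Omega)$. Merit functions: $u_0(x)=\sup_{y\in\Omega}\min_{c^*\in G}\langle c^*,F(x)-F(y)\rangle$ and, for $\ell>0$, $v_\ell(x)=\sup_{y\in\Omega}\min_{c^*\in G}\{\langle c^*,JF(x)(x-y)\rangle-\ell D_\omega(y,x)\}$; for $\ell=0$ the same formula is used with the term $\ell D_\omega(y,x)$ omitted. Values in $(-\infty,+\infty]$ are allowed. *)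

theory Defs
  imports "HOL-Analysis.Analysis"
begin

definition pointed :: "'a::real_vector set \<Rightarrow> bool" where
  "pointed C \<longleftrightarrow> C \<inter> uminus ` C = {0}"

definition cone_le :: "'a::real_vector set \<Rightarrow> 'a \<Rightarrow> 'a \<Rightarrow> bool" where
  "cone_le C y y' \<longleftrightarrow> y' - y \<in> C"

definition dual_cone :: "'a::real_inner set \<Rightarrow> 'a set" where
  "dual_cone C = {d. \<forall>c\<in>C. d \<bullet> c \<ge> 0}"

definition dual_base :: "'a::real_inner set \<Rightarrow> 'a set" where
  "dual_base C = convex hull {d \<in> dual_cone C. norm d = 1}"

(* For a closed convex pointed cone C with nonempty interior, dual_base C is compact and
   nonempty, so every infimum (supremum) over it below is an attained minimum (maximum). *)

definition min_over_base :: "'a::real_inner set \<Rightarrow> 'a \<Rightarrow> real" where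
  "min_over_base C c = (INF d\<in>dual_base C. d \<bullet> c)"

definition max_over_base :: "'a::real_inner set \<Rightarrow> 'a \<Rightarrow> real" where
  "max_over_base C c = (SUP d\<in>dual_base C. d \<bullet> c)"

definition is_e_vector :: "'a::real_inner set \<Rightarrow> real \<Rightarrow> 'a \<Rightarrow> bool" where
  "is_e_vector C r e \<longleftrightarrow>
     r > 0 \<and> is_arg_max (min_over_base C) (\<lambda>c. c \<in> cball 0 r) e \<and> max_over_base C e = 1"

definition eff_dom :: "('a \<Rightarrow> ereal) \<Rightarrow> 'a set" where
  "eff_dom f = {x. f x < \<infinity>}"

definition proper_fun :: "('a \<Rightarrow> ereal) \<Rightarrow> bool" where
  "proper_fun f \<longleftrightarrow> (\<forall>x. f x \<noteq> -\<infinity>) \<and> eff_dom f \<noteq> {}"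

definition ext_epigraph :: "('a \<Rightarrow> ereal) \<Rightarrow> ('a \<times> real) set" where
  "ext_epigraph f = {(x, t). f x \<le> ereal t}"

(* Gradient of the real-valued part; meaningful at interior points of the effective domain
   where f is differentiable. *)
definition grad :: "('a::real_inner \<Rightarrow> ereal) \<Rightarrow> 'a \<Rightarrow> 'a" where
  "grad f x = (THE g. GDERIV (\<lambda>z. real_of_ereal (f z)) x :> g)"

definition essentially_smooth :: "('a::real_inner \<Rightarrow> ereal) \<Rightarrow> bool" where
  "essentially_smooth f \<longleftrightarrow>
     (\<forall>x\<in>interior (eff_dom f). (\<lambda>z. real_of_ereal (f z)) differentiable (at x)) \<and>
     (\<forall>X. \<forall>x\<in>frontier (eff_dom f).
        (\<forall>k. X k \<in> interior (eff_dom f)) \<and> X \<longlonglongrightarrow> x \<longrightarrow>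
        filterlim (\<lambda>k. norm (grad f (X k))) at_top sequentially)"

definition strictly_convex_ext_on :: "'a::real_vector set \<Rightarrow> ('a \<Rightarrow> ereal) \<Rightarrow> bool" where
  "strictly_convex_ext_on S f \<longleftrightarrow>
     (\<forall>x\<in>S. \<forall>y\<in>S. \<forall>t. x \<noteq> y \<and> 0 < t \<and> t < 1 \<longrightarrow>
        f ((1 - t) *\<^sub>R x + t *\<^sub>R y) < ereal (1 - t) * f x + ereal t * f y)"

(* Closedness and convexity of an extended-valued function are those of its epigraph. *)
definition legendre :: "('a::real_inner \<Rightarrow> ereal) \<Rightarrow> bool" where
  "legendre f \<longleftrightarrow>
     proper_fun f \<and> closed (ext_epigraph f) \<and> convex (ext_epigraph f) \<and>
     essentially_smooth f \<and> strictly_convex_ext_on (interior (eff_dom f)) f"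

(* Intended for y in the interior of the effective domain, where \<omega> y is finite;
   the value is then \<infinity> exactly when \<omega> x = \<infinity>. *)
definition bregman :: "('a::real_inner \<Rightarrow> ereal) \<Rightarrow> 'a \<Rightarrow> 'a \<Rightarrow> ereal" where
  "bregman \<omega> x y = \<omega> x - \<omega> y - ereal (grad \<omega> y \<bullet> (x - y))"

(* If the closure of the convex set eff_dom \<omega> is \<Omega>, then interior \<Omega> is contained in
   eff_dom \<omega>, so the Bregman distances converted to real below are finite. *)
definition rel_smooth ::
  "(real^'n::finite \<Rightarrow> real^'m::finite) \<Rightarrow> real \<Rightarrow> (real^'m) set \<Rightarrow> real^'m \<Rightarrow>
   (real^'n \<Rightarrow> ereal) \<Rightarrow> (real^'n) set \<Rightarrow> bool" where
  "rel_smooth F L C e \<omega> \<Omega> \<longleftrightarrow>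
     (\<forall>x\<in>interior \<Omega>. \<forall>y\<in>interior \<Omega>.
        cone_le C (F y)
          (F x + jacobian F (at x) *v (y - x) + (L * real_of_ereal (bregman \<omega> y x)) *\<^sub>R e))"

definition rel_strongly_convex ::
  "(real^'n::finite \<Rightarrow> real^'m::finite) \<Rightarrow> real \<Rightarrow> (real^'m) set \<Rightarrow> real^'m \<Rightarrow>
   (real^'n \<Rightarrow> ereal) \<Rightarrow> (real^'n) set \<Rightarrow> bool" where
  "rel_strongly_convex F \<mu> C e \<omega> \<Omega> \<longleftrightarrow>
     (\<forall>x\<in>interior \<Omega>. \<forall>y\<in>interior \<Omega>.
        cone_le C
          (F x + jacobian F (at x) *v (y - x) + (\<mu> * real_of_ereal (bregman \<omega> y x)) *\<^sub>R e)
          (F y))"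

definition merit_u ::
  "(real^'n::finite \<Rightarrow> real^'m::finite) \<Rightarrow> (real^'m) set \<Rightarrow> (real^'n) set \<Rightarrow> real^'n \<Rightarrow> ereal" where
  "merit_u F C \<Omega> x = (SUP y\<in>\<Omega>. INF d\<in>dual_base C. ereal (d \<bullet> (F x - F y)))"

definition merit_v ::
  "(real^'n::finite \<Rightarrow> real^'m::finite) \<Rightarrow> (real^'m) set \<Rightarrow> (real^'n \<Rightarrow> ereal) \<Rightarrow> (real^'n) set \<Rightarrow>
   real \<Rightarrow> real^'n \<Rightarrow> ereal" where
  "merit_v F C \<omega> \<Omega> l x =
     (SUP y\<in>\<Omega>. INF d\<in>dual_base C.
        ereal (d \<bullet> (jacobian F (at x) *v (x - y))) -
        (if l = 0 then 0 else ereal l * bregman \<omega> y x))"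

end

theory Submission
  imports Defs
begin

text \<open>
  Every \<open>d\<close> in the base satisfies \<open>\<delta> \<le> d \<bullet> e \<le> 1\<close>, so pairing the cone inequalities with \<open>d\<close>
  compares the expressions under the suprema term by term for \<open>y\<close> in the interior of \<open>\<Omega>\<close>.
  A boundary point \<open>y\<close> is approached along the segment from \<open>x\<close>. In the smooth case the bound
  \<open>D\<^sub>\<omega>(x + t(y - x), x) \<le> t D\<^sub>\<omega>(y, x)\<close> takes the place of continuity of \<open>\<omega>\<close> at the boundary; in the
  strongly convex case only continuity of \<open>F\<close> and of the minimum over the base is needed, because
  the supremum defining \<open>v\<close> already bounds the terms along the segment.
\<close>

section \<open>Closed convex cones and the base of the dual cone\<close>

text \<open>Strict separation of \<open>z\<close> from the cone has a negative level
  \<open>b\<close>, since 0 lies in \<open>C\<close>. Scaling along rays then forces the normal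
  \<open>a\<close> to be nonnegative on \<open>C\<close>, and \<open>a\<close> can be
  normalized.\<close>

lemma closed_convex_cone_separation:
  fixes C :: "'a::euclidean_space set"
  assumes "closed C" "convex C" "cone C" "C \<noteq> {}" "z \<notin> C"
  obtains d where "d \<in> dual_cone C" "norm d = 1" "d \<bullet> z < 0"
proof -
  obtain a b where ab: "a \<bullet> z < b" "\<forall>x\<in>C. a \<bullet> x > b"
    using separating_hyperplane_closed_point assms by metis
  have "0 \<in> C" using assms cone_contains_0 by blast
  then have "b < 0" using ab by auto
  have pos: "a \<bullet> c \<ge> 0" if "c \<in> C" for c
  proof (rule ccontr)
    assume neg: "\<not> a \<bullet> c \<ge> 0"
    \<comment> \<open>The factor is a quotient of two negative numbers. It moves \<open>c\<close>
      along its ray to a point where \<open>a\<close> equals \<open>b\<close>, against the strict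
      bound on \<open>C\<close>.\<close>
    then have "(b / (a \<bullet> c)) *\<^sub>R c \<in> C"
      using \<open>cone C\<close> \<open>b < 0\<close> that unfolding cone_def
      by (simp add: divide_nonpos_nonpos)
    then have "b < a \<bullet> ((b / (a \<bullet> c)) *\<^sub>R c)" using ab by blast
    then show False using neg by auto
  qed
  have "a \<bullet> z < 0" using ab \<open>b < 0\<close> by simp
  then have "a \<noteq> 0" by auto
  show thesis
  proof (rule that[of "a /\<^sub>R norm a"])
    show "a /\<^sub>R norm a \<in> dual_cone C" using pos by (simp add: dual_cone_def)
    show "norm (a /\<^sub>R norm a) = 1" using \<open>a \<noteq> 0\<close> by simp
    show "(a /\<^sub>R norm a) \<bullet> z < 0"
      using \<open>a \<noteq> 0\<close> \<open>a \<bullet> z < 0\<close> by (simp add: mult_pos_neg)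
  qed
qed

lemma dual_base_subset_dual_cone: "dual_base C \<subseteq> dual_cone C"
proof -
  have "convex (dual_cone C)"
    unfolding dual_cone_def convex_def by (auto simp: inner_add_left)
  then show ?thesis unfolding dual_base_def by (intro hull_minimal) auto
qed

lemma dual_base_norm_le: "d \<in> dual_base C \<Longrightarrow> norm d \<le> 1"
proof -
  have "dual_base C \<subseteq> cball 0 1"
    unfolding dual_base_def by (intro hull_minimal) auto
  then show "d \<in> dual_base C \<Longrightarrow> norm d \<le> 1" by auto
qed

lemma dual_base_abs_inner_le: "d \<in> dual_base C \<Longrightarrow> \<bar>d \<bullet> z\<bar> \<le> norm z"
  using Cauchy_Schwarz_ineq2[of d z] dual_base_norm_le[of d C]
  by (meson mult_left_le_one_le norm_ge_zero order_trans)

text \<open>The real \<open>INF\<close> and \<open>SUP\<close> in \<open>min_over_base\<close> and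
  \<open>max_over_base\<close> obey the usual bound rules only on bounded sets.\<close>

lemma bdd_dual_base_inner:
  "bdd_below ((\<lambda>d. d \<bullet> z) ` dual_base C)" "bdd_above ((\<lambda>d. d \<bullet> z) ` dual_base C)"
  using dual_base_abs_inner_le[of _ C z]
  by (auto simp: abs_le_iff minus_le_iff intro!: bdd_belowI2[of _ "- norm z"] bdd_aboveI2[of _ _ "norm z"])

text \<open>A pointed cone cannot contain both a basis vector and its negative, so it misses some
  point; separating that point yields a unit dual vector.\<close>

lemma dual_base_nonempty:
  fixes C :: "'a::euclidean_space set"
  assumes "closed C" "convex C" "cone C" "pointed C"
  shows "dual_base C \<noteq> {}"
proof -
  have "C \<noteq> {}" using assms(4) by (auto simp: pointed_def)
  obtain b :: 'a where b: "b \<in> Basis" using nonempty_Basis by blast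
  then have "b \<noteq> 0" by auto
  then have "b \<notin> C \<or> - b \<notin> C" using assms(4) unfolding pointed_def by force
  then obtain z where "z \<notin> C" by blast
  then obtain d where "d \<in> dual_cone C" "norm d = 1"
    using closed_convex_cone_separation assms \<open>C \<noteq> {}\<close> by metis
  then show ?thesis unfolding dual_base_def by (metis (mono_tags, lifting) hull_inc empty_iff mem_Collect_eq)
qed

lemma min_over_base_le: "d \<in> dual_base C \<Longrightarrow> min_over_base C z \<le> d \<bullet> z"
  unfolding min_over_base_def by (rule cINF_lower[OF bdd_dual_base_inner(1)])

lemma max_over_base_ge: "d \<in> dual_base C \<Longrightarrow> d \<bullet> z \<le> max_over_base C z"
  unfolding max_over_base_def by (rule cSUP_upper[OF _ bdd_dual_base_inner(2)])

text \<open>Turns the inner infimum of \<open>merit_u\<close> into a real number. An empty base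
  would give \<infinity> on the left.\<close>

lemma ereal_min_over_base:
  assumes "dual_base C \<noteq> {}"
  shows "(INF d\<in>dual_base C. ereal (d \<bullet> z)) = ereal (min_over_base C z)"
  using ereal_Inf'[OF bdd_dual_base_inner(1), of z C] assms
  by (simp add: min_over_base_def image_comp)

text \<open>The base lies in the unit ball, so its minimum is 1-Lipschitz. This supplies the
  continuity needed at boundary points.\<close>

lemma min_over_base_diff_le:
  assumes "dual_base C \<noteq> {}"
  shows "min_over_base C z - norm (z - z') \<le> min_over_base C z'"
  unfolding min_over_base_def[of C z']
proof (rule cINF_greatest[OF assms])
  fix d assume d: "d \<in> dual_base C"
  have "d \<bullet> z - d \<bullet> z' \<le> norm (z - z')"
    using dual_base_abs_inner_le[OF d, of "z - z'"] by (simp add: inner_diff_right)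
  then show "min_over_base C z - norm (z - z') \<le> d \<bullet> z'"
    using min_over_base_le[OF d, of z] by simp
qed

text \<open>The ball contains 0, whose minimum over the base is 0, so the maximizer \<open>e\<close>
  has a nonnegative minimum. The upper bound is the normalization that fixes
  \<open>r\<close>.\<close>

lemma is_e_vector_inner_bounds:
  assumes "is_e_vector C r e" "dual_base C \<noteq> {}" "d \<in> dual_base C"
  shows "0 \<le> d \<bullet> e" "d \<bullet> e \<le> 1"
proof -
  have "min_over_base C 0 = 0" using assms(2) by (simp add: min_over_base_def)
  then have "0 \<le> min_over_base C e"
    using assms(1) unfolding is_e_vector_def is_arg_max_def
    by (metis centre_in_cball less_eq_real_def not_le)
  then show "0 \<le> d \<bullet> e" using min_over_base_le[OF assms(3), of e] by simp
  show "d \<bullet> e \<le> 1"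
    using max_over_base_ge[OF assms(3), of e] assms(1) by (simp add: is_e_vector_def)
qed

text \<open>Bipolar argument: a vector outside \<open>C\<close> is negative on some unit dual
  vector, which contradicts the lower bound on the base.\<close>

lemma is_e_vector_in_cone:
  fixes C :: "'a::euclidean_space set"
  assumes "closed C" "convex C" "cone C" "pointed C" "is_e_vector C r e"
  shows "e \<in> C"
proof (rule ccontr)
  assume "e \<notin> C"
  moreover have "C \<noteq> {}" using assms(4) by (auto simp: pointed_def)
  ultimately obtain d where d: "d \<in> dual_cone C" "norm d = 1" "d \<bullet> e < 0"
    using closed_convex_cone_separation assms(1-3) by metis
  then have "d \<in> dual_base C" unfolding dual_base_def by (simp add: hull_inc)
  then show False
    using is_e_vector_inner_bounds(1)[OF assms(5) dual_base_nonempty[OF assms(1-4)]] d(3)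
    by fastforce
qed

section \<open>Extended-valued convex functions and Bregman distances\<close>

lemma proper_fun_real:
  "proper_fun f \<Longrightarrow> x \<in> eff_dom f \<Longrightarrow> f x = ereal (real_of_ereal (f x))"
  unfolding proper_fun_def eff_dom_def by (cases "f x") auto

lemma convex_epigraph_segment:
  assumes "proper_fun f" "convex (ext_epigraph f)" "x \<in> eff_dom f" "y \<in> eff_dom f"
    and t: "0 \<le> t" "t \<le> 1"
  shows "f (x + t *\<^sub>R (y - x)) \<le>
    ereal ((1 - t) * real_of_ereal (f x) + t * real_of_ereal (f y))"
proof -
  have "(x, real_of_ereal (f x)) \<in> ext_epigraph f" "(y, real_of_ereal (f y)) \<in> ext_epigraph f"
    using proper_fun_real[OF assms(1)] assms(3,4) by (auto simp: ext_epigraph_def)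
  then have "(1 - t) *\<^sub>R (x, real_of_ereal (f x)) + t *\<^sub>R (y, real_of_ereal (f y)) \<in> ext_epigraph f"
    using assms(2) t by (intro convexD) auto
  moreover have "x + t *\<^sub>R (y - x) = (1 - t) *\<^sub>R x + t *\<^sub>R y" by (simp add: algebra_simps)
  ultimately show ?thesis by (simp add: ext_epigraph_def)
qed

lemma convex_eff_dom:
  assumes "proper_fun f" "convex (ext_epigraph f)"
  shows "convex (eff_dom f)"
  unfolding convex_alt
proof (intro ballI allI impI)
  fix x y and t :: real assume "x \<in> eff_dom f" "y \<in> eff_dom f" "0 \<le> t \<and> t \<le> 1"
  then have "f (x + t *\<^sub>R (y - x)) < \<infinity>"
    using convex_epigraph_segment[OF assms] by (meson le_less_trans less_ereal.simps(4))
  moreover have "x + t *\<^sub>R (y - x) = (1 - t) *\<^sub>R x + t *\<^sub>R y" by (simp add: algebra_simps)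
  ultimately show "(1 - t) *\<^sub>R x + t *\<^sub>R y \<in> eff_dom f" by (simp add: eff_dom_def)
qed

lemma convex_on_real_of_ereal:
  assumes "proper_fun f" "convex (ext_epigraph f)"
  shows "convex_on (eff_dom f) (\<lambda>z. real_of_ereal (f z))"
proof (rule convex_onI[OF _ convex_eff_dom[OF assms]])
  fix t :: real and x y
  assume t: "0 < t" "t < 1" and xy: "x \<in> eff_dom f" "y \<in> eff_dom f"
  have eq: "x + t *\<^sub>R (y - x) = (1 - t) *\<^sub>R x + t *\<^sub>R y" by (simp add: algebra_simps)
  then have "x + t *\<^sub>R (y - x) \<in> eff_dom f"
    using convexD_alt[OF convex_eff_dom[OF assms] xy, of t] t by simp
  from proper_fun_real[OF assms(1) this]
  show "real_of_ereal (f ((1 - t) *\<^sub>R x + t *\<^sub>R y))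
      \<le> (1 - t) * real_of_ereal (f x) + t * real_of_ereal (f y)"
    using convex_epigraph_segment[OF assms xy, of t] t
    by (metis eq ereal_less_eq(3) less_eq_real_def)
qed

text \<open>Since \<open>grad\<close> is a definite description, both existence and uniqueness are
  needed. The Riesz representative of the derivative \<open>D\<close> is
  \<open>adjoint D 1\<close>.\<close>

lemma GDERIV_grad:
  fixes f :: "'a::euclidean_space \<Rightarrow> ereal"
  assumes "(\<lambda>z. real_of_ereal (f z)) differentiable (at x)"
  shows "GDERIV (\<lambda>z. real_of_ereal (f z)) x :> grad f x"
proof -
  let ?w = "\<lambda>z. real_of_ereal (f z)"
  obtain D where D: "(?w has_derivative D) (at x)"
    using assms by (auto simp: differentiable_def)
  have "D = (\<lambda>h. h \<bullet> adjoint D 1)"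
    using adjoint_works[OF has_derivative_linear[OF D], of _ 1] by simp
  then have G: "GDERIV ?w x :> adjoint D 1" using D by (simp add: gderiv_def)
  moreover have "g = adjoint D 1" if "GDERIV ?w x :> g" for g
    using has_derivative_unique[OF that[unfolded gderiv_def] G[unfolded gderiv_def]]
    by (metis vector_eq_rdot inner_commute)
  ultimately show ?thesis unfolding grad_def by (rule theI)
qed

text \<open>By convexity every difference quotient along the segment from \<open>x\<close> to
  \<open>y\<close> is at most \<open>w y - w x\<close>; the quotients tend to the directional
  derivative.\<close>

lemma convex_on_above_tangent:
  fixes w :: "'a::real_inner \<Rightarrow> real"
  assumes "convex_on S w" "GDERIV w x :> g" "x \<in> S" "y \<in> S"
  shows "g \<bullet> (y - x) \<le> w y - w x"
proof -
  let ?p = "\<lambda>t::real. w (x + t *\<^sub>R (y - x))"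
  \<comment> \<open>The base point is written as the value of the segment at 0 so that the chain
    rule matches.\<close>
  have "(w has_derivative (\<lambda>h. h \<bullet> g)) (at (x + 0 *\<^sub>R (y - x)))"
    using assms(2) by (simp add: gderiv_def)
  then have "(?p has_derivative (\<lambda>t. (t *\<^sub>R (y - x)) \<bullet> g)) (at 0)"
    by (rule has_derivative_compose[rotated]) (auto intro!: derivative_eq_intros)
  then have "(?p has_real_derivative g \<bullet> (y - x)) (at 0)"
    unfolding has_field_derivative_def
    by (rule has_derivative_eq_rhs) (auto simp: fun_eq_iff inner_commute)
  then have lim: "((\<lambda>t. (?p t - ?p 0) / t) \<longlongrightarrow> g \<bullet> (y - x)) (at_right 0)"
    unfolding has_field_derivative_iff by (auto intro: tendsto_within_subset)
  have le: "(?p t - ?p 0) / t \<le> w y - w x" if t: "0 < t" "t < 1" for t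
  proof -
    have "x + t *\<^sub>R (y - x) = (1 - t) *\<^sub>R x + t *\<^sub>R y" by (simp add: algebra_simps)
    then have "?p t \<le> (1 - t) * w x + t * w y"
      using convex_onD[OF assms(1), of t x y] t assms(3,4) by simp
    then have "?p t - ?p 0 \<le> (w y - w x) * t" by (simp add: algebra_simps)
    then show ?thesis using t by (simp add: pos_divide_le_eq)
  qed
  have "eventually (\<lambda>t. (?p t - ?p 0) / t \<le> w y - w x) (at_right 0)"
    using le by (auto simp: eventually_at_right_field intro!: exI[of _ 1])
  with lim show ?thesis by (intro tendsto_upperbound) auto
qed

lemma bregman_eq_real:
  assumes "proper_fun f" "x \<in> eff_dom f" "y \<in> eff_dom f"
  shows "bregman f y x =
    ereal (real_of_ereal (f y) - real_of_ereal (f x) - grad f x \<bullet> (y - x))"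
  unfolding bregman_def
  using proper_fun_real[OF assms(1,2)] proper_fun_real[OF assms(1,3)]
  by (metis minus_ereal_def ereal_minus(1))

lemma bregman_outside_eff_dom:
  assumes "proper_fun f" "x \<in> eff_dom f" "y \<notin> eff_dom f"
  shows "bregman f y x = \<infinity>"
  unfolding bregman_def using proper_fun_real[OF assms(1,2)] assms(3)
  by (cases "f x") (auto simp: eff_dom_def)

lemma legendre_GDERIV:
  fixes f :: "'a::euclidean_space \<Rightarrow> ereal"
  assumes "legendre f" "x \<in> interior (eff_dom f)"
  shows "GDERIV (\<lambda>z. real_of_ereal (f z)) x :> grad f x"
  using assms by (intro GDERIV_grad) (auto simp: legendre_def essentially_smooth_def)

lemma bregman_nonneg:
  fixes f :: "'a::euclidean_space \<Rightarrow> ereal"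
  assumes "legendre f" "x \<in> interior (eff_dom f)" "y \<in> eff_dom f"
  shows "0 \<le> real_of_ereal (bregman f y x)"
proof -
  have f: "proper_fun f" "convex (ext_epigraph f)" using assms(1) by (auto simp: legendre_def)
  have x: "x \<in> eff_dom f" using assms(2) interior_subset by blast
  show ?thesis
    using convex_on_above_tangent[OF convex_on_real_of_ereal[OF f] legendre_GDERIV[OF assms(1,2)] x assms(3)]
    by (simp add: bregman_eq_real[OF f(1) x assms(3)])
qed

text \<open>In its first argument the Bregman distance is \<open>f\<close> plus an affine term,
  hence convex, and it vanishes at \<open>x\<close>.\<close>

lemma bregman_segment_le:
  assumes "proper_fun f" "convex (ext_epigraph f)" "x \<in> eff_dom f" "y \<in> eff_dom f"
    and "0 \<le> t" "t \<le> 1"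
  shows "real_of_ereal (bregman f (x + t *\<^sub>R (y - x)) x) \<le> t * real_of_ereal (bregman f y x)"
proof -
  have eq: "x + t *\<^sub>R (y - x) = (1 - t) *\<^sub>R x + t *\<^sub>R y" by (simp add: algebra_simps)
  have "x + t *\<^sub>R (y - x) \<in> eff_dom f"
    using convexD_alt[OF convex_eff_dom[OF assms(1,2)] assms(3,4), of t] assms(5,6)
    by (simp add: eq)
  then show ?thesis
    using convex_onD[OF convex_on_real_of_ereal[OF assms(1,2)] assms(5,6,3,4)] assms
    by (simp add: bregman_eq_real eq[symmetric] algebra_simps inner_diff_right inner_add_right)
qed

section \<open>Comparison of the merit functions\<close>

text \<open>The relative inequalities are assumed only between interior points; the half-open
  segment towards a boundary point stays within their reach.\<close>

lemma convex_segment_interior: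
  fixes S :: "'a::euclidean_space set"
  assumes "convex S" "x \<in> interior S" "y \<in> S" "0 \<le> t" "t < 1"
  shows "x + t *\<^sub>R (y - x) \<in> interior S"
  using mem_interior_convex_shrink[OF assms(1-3), of "1 - t"] assms(4,5)
  by (simp add: algebra_simps)

text \<open>The comparison is made for every \<open>y\<close> and \<open>d\<close> separately and
  passes through infimum and supremum by monotonicity.\<close>

lemma merit_v_le_merit_u:
  fixes C :: "(real^'m::finite) set" and F :: "real^'n::finite \<Rightarrow> real^'m"
  assumes C: "closed C" "convex C" "cone C" "pointed C"
    and \<Omega>: "convex \<Omega>" "closure (eff_dom \<omega>) = \<Omega>"
    and F: "\<And>x. F differentiable (at x)"
    and \<omega>: "legendre \<omega>"
    and e: "is_e_vector C r e"
    and "L > 0" and smooth: "rel_smooth F L C e \<omega> \<Omega>"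
    and x: "x \<in> interior \<Omega>"
  shows "merit_v F C \<omega> \<Omega> L x \<le> merit_u F C \<Omega> x"
proof -
  let ?J = "jacobian F (at x)"
  have f: "proper_fun \<omega>" "convex (ext_epigraph \<omega>)" using \<omega> by (auto simp: legendre_def)
  \<comment> \<open>A convex set and its closure have the same interior, so \<omega> is
    differentiable at \<open>x\<close>.\<close>
  have xi: "x \<in> interior (eff_dom \<omega>)"
    using x convex_interior_closure[OF convex_eff_dom[OF f]] \<Omega>(2) by simp
  then have xd: "x \<in> eff_dom \<omega>" using interior_subset by blast
  have "ereal (d \<bullet> (?J *v (x - y))) - ereal L * bregman \<omega> y x \<le> ereal (d \<bullet> (F x - F y))"
    if y: "y \<in> \<Omega>" and d: "d \<in> dual_base C" for y d
  proof (cases "y \<in> eff_dom \<omega>")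
    case False
    \<comment> \<open>Here the Bregman distance is \<infinity> and \<open>L > 0\<close>, so the left
      side is -\<infinity>.\<close>
    then show ?thesis using bregman_outside_eff_dom[OF f(1) xd] \<open>L > 0\<close> by simp
  next
    case True
    define B where "B = real_of_ereal (bregman \<omega> y x)"
    have B: "bregman \<omega> y x = ereal B" "0 \<le> B"
      unfolding B_def using bregman_eq_real[OF f(1) xd True] bregman_nonneg[OF \<omega> xi True] by auto
    let ?s = "\<lambda>t. x + t *\<^sub>R (y - x)"
    \<comment> \<open>The slack of the smoothness inequality at \<open>?s t\<close>, with the
      Bregman distance raised to its bound \<open>t * B\<close>. It is continuous in
      \<open>t\<close> even where \<omega> is not; raising is allowed because \<open>e\<close> lies
      in \<open>C\<close>.\<close>
    let ?h = "\<lambda>t. F x + ?J *v (?s t - x) + (L * (t * B)) *\<^sub>R e - F (?s t)"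
    have "?h t \<in> C" if t: "0 \<le> t" "t < 1" for t
    proof -
      let ?b = "real_of_ereal (bregman \<omega> (?s t) x)"
      have 1: "F x + ?J *v (?s t - x) + (L * ?b) *\<^sub>R e - F (?s t) \<in> C"
        using smooth x convex_segment_interior[OF \<Omega>(1) x y t]
        unfolding rel_smooth_def cone_le_def by blast
      have "0 \<le> L * (t * B - ?b)"
        using bregman_segment_le[OF f xd True, of t] t \<open>L > 0\<close> by (simp add: B_def)
      then have 2: "(L * (t * B - ?b)) *\<^sub>R e \<in> C"
        using is_e_vector_in_cone[OF C e] C(3) unfolding cone_def by blast
      have "?h t = (F x + ?J *v (?s t - x) + (L * ?b) *\<^sub>R e - F (?s t)) + (L * (t * B - ?b)) *\<^sub>R e"
        by (simp add: algebra_simps)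
      then show ?thesis using 1 2 C(2,3) convex_cone by metis
    qed
    then have ev: "eventually (\<lambda>t. ?h t \<in> C) (at_left 1)"
      by (auto simp: eventually_at_left_field intro!: exI[of _ 0])
    have contF: "isCont F z" for z using F differentiable_imp_continuous_within by blast
    have s: "(?s \<longlongrightarrow> ?s 1) (at_left 1)" by (intro tendsto_intros)
    have "(?h \<longlongrightarrow> ?h 1) (at_left 1)"
      by (intro tendsto_intros isCont_tendsto_compose[OF contF] s
        linear_continuous_at[THEN isCont_tendsto_compose, OF matrix_vector_mul_bounded_linear])
    from Lim_in_closed_set[OF C(1) ev _ this]
    have "F x + ?J *v (y - x) + (L * B) *\<^sub>R e - F y \<in> C" by simp
    then have "0 \<le> d \<bullet> (F x + ?J *v (y - x) + (L * B) *\<^sub>R e - F y)"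
      using d dual_base_subset_dual_cone unfolding dual_cone_def by blast
    moreover have "?J *v (x - y) = - (?J *v (y - x))"
      by (simp add: matrix_vector_mult_diff_distrib)
    \<comment> \<open>Removes \<open>e\<close> from the paired inequality, using
      \<open>d \<bullet> e \<le> 1\<close> and \<open>B \<ge> 0\<close>.\<close>
    moreover have "L * B * (d \<bullet> e) \<le> L * B"
      using is_e_vector_inner_bounds(2)[OF e dual_base_nonempty[OF C] d] B(2) \<open>L > 0\<close>
      by (simp add: mult_left_le)
    ultimately show ?thesis by (simp add: B(1) inner_add_right inner_diff_right)
  qed
  then show ?thesis
    unfolding merit_v_def merit_u_def using \<open>L > 0\<close>
    by (auto intro!: SUP_subset_mono INF_superset_mono)
qed

lemma merit_u_le_merit_v:
  fixes C :: "(real^'m::finite) set" and F :: "real^'n::finite \<Rightarrow> real^'m"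
  assumes C: "closed C" "convex C" "cone C" "pointed C"
    and \<Omega>: "convex \<Omega>" "closure (eff_dom \<omega>) = \<Omega>"
    and F: "\<And>x. F differentiable (at x)"
    and \<omega>: "legendre \<omega>"
    and "\<mu> \<ge> 0" and sconv: "rel_strongly_convex F \<mu> C e \<omega> \<Omega>"
    and x: "x \<in> interior \<Omega>"
  shows "merit_u F C \<Omega> x \<le> merit_v F C \<omega> \<Omega> (min_over_base C e * \<mu>) x"
    (is "_ \<le> ?v")
proof -
  let ?J = "jacobian F (at x)" and ?\<delta> = "min_over_base C e"
  have f: "proper_fun \<omega>" "convex (ext_epigraph \<omega>)" using \<omega> by (auto simp: legendre_def)
  have ne: "dual_base C \<noteq> {}" by (rule dual_base_nonempty[OF C])
  have int: "interior \<Omega> = interior (eff_dom \<omega>)"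
    using convex_interior_closure[OF convex_eff_dom[OF f]] \<Omega>(2) by simp
  \<comment> \<open>The bound \<open>?v\<close> does not depend on \<open>z\<close>, so for a
    boundary point only the left side has to pass to the limit.\<close>
  have inside: "ereal (min_over_base C (F x - F z)) \<le> ?v" if z: "z \<in> interior \<Omega>" for z
  proof -
    have zd: "z \<in> eff_dom \<omega>" "x \<in> eff_dom \<omega>" "x \<in> interior (eff_dom \<omega>)"
      using z x int interior_subset by blast+
    define B where "B = real_of_ereal (bregman \<omega> z x)"
    have B: "bregman \<omega> z x = ereal B" "0 \<le> B"
      unfolding B_def using bregman_eq_real[OF f(1) zd(2,1)] bregman_nonneg[OF \<omega> zd(3,1)] by auto
    have mem: "F z - (F x + ?J *v (z - x) + (\<mu> * B) *\<^sub>R e) \<in> C"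
      using sconv x z unfolding rel_strongly_convex_def cone_le_def B_def by blast
    have "ereal (min_over_base C (F x - F z)) \<le> ereal (d \<bullet> (?J *v (x - z))) -
        (if ?\<delta> * \<mu> = 0 then 0 else ereal (?\<delta> * \<mu>) * bregman \<omega> z x)"
      if d: "d \<in> dual_base C" for d
    proof -
      have "0 \<le> d \<bullet> (F z - (F x + ?J *v (z - x) + (\<mu> * B) *\<^sub>R e))"
        using mem d dual_base_subset_dual_cone unfolding dual_cone_def by blast
      moreover have "?J *v (x - z) = - (?J *v (z - x))"
        by (simp add: matrix_vector_mult_diff_distrib)
      \<comment> \<open>Source of the factor \<delta>: the pairing \<open>d \<bullet> e\<close> is
        replaced by its least value over the base.\<close>
      moreover have "\<mu> * B * ?\<delta> \<le> \<mu> * B * (d \<bullet> e)"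
        using min_over_base_le[OF d, of e] B(2) \<open>\<mu> \<ge> 0\<close> by (intro mult_left_mono) auto
      ultimately have "d \<bullet> (F x - F z) \<le> d \<bullet> (?J *v (x - z)) - ?\<delta> * \<mu> * B"
        by (simp add: inner_add_right inner_diff_right algebra_simps)
      then have "ereal (min_over_base C (F x - F z)) \<le> ereal (d \<bullet> (?J *v (x - z)) - ?\<delta> * \<mu> * B)"
        using min_over_base_le[OF d, of "F x - F z"] by simp
      also have "\<dots> = ereal (d \<bullet> (?J *v (x - z))) -
          (if ?\<delta> * \<mu> = 0 then 0 else ereal (?\<delta> * \<mu>) * bregman \<omega> z x)"
        \<comment> \<open>Both branches agree because the Bregman distance is the finite number
          \<open>B\<close>, so a zero coefficient gives 0.\<close>
        by (auto simp: B(1))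
      finally show ?thesis .
    qed
    then have "ereal (min_over_base C (F x - F z)) \<le>
      (INF d\<in>dual_base C. ereal (d \<bullet> (?J *v (x - z))) -
        (if ?\<delta> * \<mu> = 0 then 0 else ereal (?\<delta> * \<mu>) * bregman \<omega> z x))"
      by (intro INF_greatest)
    also have "\<dots> \<le> ?v"
      unfolding merit_v_def using z interior_subset by (intro SUP_upper) auto
    finally show ?thesis .
  qed
  have "ereal (min_over_base C (F x - F y)) \<le> ?v" if y: "y \<in> \<Omega>" for y
  proof -
    let ?s = "\<lambda>t. x + t *\<^sub>R (y - x)"
    \<comment> \<open>A Lipschitz lower bound for the minimum at \<open>?s t\<close>; its correction
      term vanishes at \<open>t = 1\<close>, where \<open>?s t\<close> is \<open>y\<close>.\<close>
    let ?h = "\<lambda>t. ereal (min_over_base C (F x - F y) - norm ((F x - F y) - (F x - F (?s t))))"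
    have "?h t \<le> ?v" if t: "0 \<le> t" "t < 1" for t
      using inside[OF convex_segment_interior[OF \<Omega>(1) x y t]]
        min_over_base_diff_le[OF ne, of "F x - F y" "F x - F (?s t)"]
      by (meson ereal_less_eq(3) order_trans)
    then have ev: "eventually (\<lambda>t. ?h t \<le> ?v) (at_left 1)"
      by (auto simp: eventually_at_left_field intro!: exI[of _ 0])
    have contF: "isCont F z" for z using F differentiable_imp_continuous_within by blast
    have s: "(?s \<longlongrightarrow> ?s 1) (at_left 1)" by (intro tendsto_intros)
    have "(?h \<longlongrightarrow> ?h 1) (at_left 1)"
      by (intro tendsto_intros tendsto_ereal isCont_tendsto_compose[OF contF] s)
    from tendsto_upperbound[OF this ev] show ?thesis by simp
  qed
  then show ?thesis
    unfolding merit_u_def ereal_min_over_base[OF ne] by (intro SUP_least)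
qed

theorem proposition6:
  fixes C :: "(real^'m::finite) set"
    and \<Omega> :: "(real^'n::finite) set"
    and F :: "real^'n \<Rightarrow> real^'m"
    and \<omega> :: "real^'n \<Rightarrow> ereal"
    and e :: "real^'m"
    and r \<delta> :: real
  assumes "closed C" and "convex C" and "cone C" and "pointed C" and "interior C \<noteq> {}"
    and "closed \<Omega>" and "convex \<Omega>" and "interior \<Omega> \<noteq> {}"
    and "\<forall>x. F differentiable (at x)"
    and "legendre \<omega>" and "closure (eff_dom \<omega>) = \<Omega>"
    and "is_e_vector C r e"
    and "\<delta> = min_over_base C e"
  shows "(\<forall>L>0. rel_smooth F L C e \<omega> \<Omega> \<longrightarrow>
            (\<forall>x\<in>interior \<Omega>. merit_v F C \<omega> \<Omega> L x \<le> merit_u F C \<Omega> x)) \<and>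
         (\<forall>\<mu>\<ge>0. rel_strongly_convex F \<mu> C e \<omega> \<Omega> \<longrightarrow>
            (\<forall>x\<in>interior \<Omega>. merit_u F C \<Omega> x \<le> merit_v F C \<omega> \<Omega> (\<delta> * \<mu>) x))"
  using merit_v_le_merit_u[where C = C and F = F and \<omega> = \<omega> and \<Omega> = \<Omega> and e = e and r = r]
    merit_u_le_merit_v[where C = C and F = F and \<omega> = \<omega> and \<Omega> = \<Omega> and e = e]
    assms by blast

end
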